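(* Let $\alpha>0$ and let $X_\alpha=\{X_\alpha(t),t\in\mathbb R^+\}$ be an $\alpha$-permanental process, with continuous sample paths, with kernel $u(s,t)$ and sigma function $\sigma(s,t)$. Suppose there is an increasing function $\varphi$ such that $\sigma(s,t)\le\varphi(|t-s|)$ for all $0\le s,t<\infty$ and $$\int_0^{1/2}\frac{\varphi(u)}{u(\log 1/u)^{1/2}}\,du<\infty.$$ Then $$\limsup_{t\to\infty}\frac{X_\alpha(t)}{u^*(t,t)\log t}\le1\qquad a.s.,$$ where $u^*(t,t)=\sup_{s\le t}u(s,s)$.
   Context: For $\alpha>0$, a random vector $(X_1,\dots,X_n)$ with nonnegative components is $\alpha$-permanental with kernel $U$ (a real $n\times n$ matrix) if $E\big(e^{-\sum_{i=1}^n s_iX_i}\big)=|I+US|^{-\alpha}$ for every diagonal matrix $S$ with positive diagonal entries $s_1,\dots,s_n$, where $|\cdot|$ denotes the determinant. A stochastic process $\{X_\alpha(t),t\in\mathcal T\}$ is an $\alpha$-permanental process with kernel $\{u(s,t),s,t\in\mathcal T\}$ if for all $t_1,\dots,t_n\in\mathcal T$ the vector $(X_\alpha(t_1),\dots,X_\alpha(t_n))$ is $\alpha$-permanental with kernel $\{u(t_i,t_j)\}_{i,j=1}^n$. Its sigma function is $\sigma(s,t)=\big(u(s,s)+u(t,t)-2(u(s,t)u(t,s))^{1/2}\big)^{1/2}$ (all quantities under the square roots are known to be nonnegative). Standing assumption on kernels: $\sup_{t\le\delta}u(t,t)>0$ for all $\delta>0$. $\mathbb R^+=[0,\infty)$.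 *)

theory Defs
  imports "HOL-Probability.Probability" "Jordan_Normal_Form.Determinant"
begin

text \<open>
  The law of a vector of random variables \<open>Y 0, \<dots>, Y (n - 1)\<close> being \<open>\<alpha>\<close>-permanental with
  kernel \<open>U\<close>.  The Laplace transform formula involves a real power of \<open>det (I + U S)\<close> and is
  meaningful only if this determinant is positive.  Positivity is recorded explicitly because
  \<^term>\<open>(powr)\<close> is a total function; it in fact follows from the formula, since the determinant
  is continuous in \<open>s\<close>, tends to \<open>1\<close> as \<open>s \<rightarrow> 0\<close>, and cannot vanish.
\<close>

definition permanental_vector ::
  "'a measure \<Rightarrow> real \<Rightarrow> nat \<Rightarrow> real mat \<Rightarrow> (nat \<Rightarrow> 'a \<Rightarrow> real) \<Rightarrow> bool" where
  "permanental_vector M \<alpha> n U Y \<longleftrightarrow>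
     U \<in> carrier_mat n n \<and>
     (\<forall>i<n. Y i \<in> borel_measurable M \<and> (AE \<omega> in M. 0 \<le> Y i \<omega>)) \<and>
     (\<forall>s. (\<forall>i<n. 0 < s i) \<longrightarrow>
        0 < Determinant.det (1\<^sub>m n + U * mat_diag n s) \<and>
        (\<integral>\<omega>. exp (- (\<Sum>i<n. s i * Y i \<omega>)) \<partial>M) =
          Determinant.det (1\<^sub>m n + U * mat_diag n s) powr (- \<alpha>))"

definition permanental_process ::
  "'a measure \<Rightarrow> real \<Rightarrow> 't set \<Rightarrow> ('t \<Rightarrow> 't \<Rightarrow> real) \<Rightarrow> ('t \<Rightarrow> 'a \<Rightarrow> real) \<Rightarrow> bool" where
  "permanental_process M \<alpha> T u X \<longleftrightarrow>
     (\<forall>n t. 1 \<le> n \<longrightarrow> (\<forall>i<n. t i \<in> T) \<longrightarrow>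
        permanental_vector M \<alpha> n (Matrix.mat n n (\<lambda>(i, j). u (t i) (t j))) (\<lambda>i. X (t i)))"

definition sigma_fun :: "('t \<Rightarrow> 't \<Rightarrow> real) \<Rightarrow> 't \<Rightarrow> 't \<Rightarrow> real" where
  "sigma_fun u s t = sqrt (u s s + u t t - 2 * sqrt (u s t * u t s))"

text \<open>
  The supremum below is taken in \<^typ>\<open>real\<close>, so it has its usual meaning when \<open>s \<mapsto> u s s\<close> is
  bounded above on \<open>[0, t]\<close>.  This is automatic for the kernel of a permanental process with
  continuous paths, as the variable at \<open>s\<close> is \<open>u s s\<close> times a standard Gamma variable.
\<close>

definition ustar :: "(real \<Rightarrow> real \<Rightarrow> real) \<Rightarrow> real \<Rightarrow> real" where
  "ustar u t = (SUP s\<in>{0..t}. u s s)"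

end

theory Submission imports Defs begin

text \<open>
  At a fixed time, \<open>X t\<close> is \<open>u t t\<close> times a standard Gamma variable, whose tail is roughly
  \<open>exp (- x)\<close>.  By the Borel-Cantelli lemma, along any grid with a fixed number of points per unit
  interval, \<open>X t\<close> is eventually below \<open>(1 + \<epsilon>) * ustar u t * ln t\<close>.  What remains is to show that
  between neighbouring grid points \<open>X\<close> grows by at most a small multiple of \<open>ustar u t * ln t\<close>,
  the multiple tending to \<open>0\<close> with the grid spacing.  This is done by chaining.

  The kernel need not be symmetric, so in general there is no Gaussian process behind \<open>X\<close>.
  Chaining however uses only the laws of pairs, and these depend on the kernel only through \<open>u s s\<close>,
  \<open>u t t\<close> and the product \<open>u s t * u t s\<close>.  The Laplace transform of a pair extends to negative
  values of one parameter (\<open>mgf_from_laplace\<close>), and the resulting determinant is compared with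
  \<open>1 - \<kappa> * \<sigma> ^ 2\<close> in \<open>two_point_mgf_increment\<close>.  This yields, for every \<open>\<eta> > 0\<close>,
  \<open>X t \<le> (1 + \<eta>) * X s + (1 + \<eta>) * \<eta> * L\<close> outside an event of probability of order
  \<open>exp (- \<eta> ^ 2 * L / (2 * \<sigma> ^ 2))\<close> (\<open>increment_tail\<close>).  Square roots of \<open>X\<close> are thereby avoided.

  The grids have spacing \<open>(1/2) ^ (2 ^ j)\<close>.  With \<open>L = ln n\<close> on \<open>[n, n + 1)\<close> and \<open>\<eta>\<close> essentially a
  constant times \<open>\<phi> ((1/2) ^ (2 ^ j)) * sqrt (2 ^ j)\<close> on level \<open>j\<close>, almost surely all links hold on all levels
  for large \<open>n\<close> (\<open>AE_eventually_links\<close>).  The integral condition makes these \<open>\<eta>\<close>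
  summable (\<open>double_exponential_scale_summable\<close>).  Along a chain starting on level \<open>p\<close>, the
  quantity \<open>X + L\<close> is multiplied by at most the exponential of twice the tail sum of \<open>\<eta>\<close> from \<open>p\<close>
  on (\<open>chain_bound\<close>), which tends to \<open>1\<close> as \<open>p\<close> grows, and continuity of the paths carries the bound
  from grid points to all times.
\<close>

section \<open>From the Laplace transform to exponential moments\<close>

text \<open>
  Divide by the power of \<open>h\<close> belonging to the first coefficient not yet known to vanish, and let
  \<open>h\<close> tend to \<open>0\<close> from the right.
\<close>

lemma power_series_eq_zero_on_right:
  fixes d :: "nat \<Rightarrow> real"
  assumes r: "0 < r" and d: "\<And>h. 0 < h \<Longrightarrow> h < r \<Longrightarrow> (\<lambda>k. d k * h ^ k) sums 0"
  shows "d n = 0"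
proof (induction n rule: less_induct)
  case (less n)
  define e where "e k = d (k + n)" for k
  have e: "(\<lambda>k. e k * h ^ k) sums 0" if "0 < h" "h < r" for h
  proof -
    have "(\<lambda>k. d (k + n) * h ^ (k + n)) sums (0 - (\<Sum>k<n. d k * h ^ k))"
      by (rule sums_split_initial_segment[OF d[OF that]])
    then have "(\<lambda>k. d (k + n) * h ^ (k + n)) sums 0"
      using less by simp
    from sums_divide[OF this, of "h ^ n"] show ?thesis
      using that by (simp add: e_def power_add)
  qed
  have "((\<lambda>x. \<Sum>k. e k * x ^ k) \<longlongrightarrow> e 0) (at 0)"
  proof (rule powser_limit_0[OF r])
    fix x :: real assume "norm x < r"
    then obtain h where h: "norm x < h" "h < r" using dense by blast
    have "summable (\<lambda>k. e k * h ^ k)"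
      using e[of h] h by (intro sums_summable[of _ 0]) auto
    then have "summable (\<lambda>k. e k * x ^ k)"
      by (rule powser_inside) (use h in auto)
    then show "(\<lambda>k. e k * x ^ k) sums (\<Sum>k. e k * x ^ k)" by (rule summable_sums)
  qed
  then have "((\<lambda>x. \<Sum>k. e k * x ^ k) \<longlongrightarrow> e 0) (at_right 0)"
    by (rule tendsto_mono[rotated]) (simp add: at_le)
  moreover have "((\<lambda>x. \<Sum>k. e k * x ^ k) \<longlongrightarrow> 0) (at_right 0)"
  proof (rule tendsto_eventually)
    show "\<forall>\<^sub>F x in at_right 0. (\<Sum>k. e k * x ^ k) = 0"
      unfolding eventually_at_right_field using r e by (metis sums_unique)
  qed
  ultimately have "e 0 = 0" by (intro tendsto_unique[of "at_right (0::real)"]) auto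
  then show ?case by (simp add: e_def)
qed

text \<open>
  Expand both sides around \<open>s = 1\<close>, in the variable \<open>h = 1 - s\<close>.  The left-hand side becomes the
  power series whose coefficients are the moments of \<open>X\<close> under the weight \<open>W exp (- X)\<close>, the
  right-hand side a binomial series; they agree for \<open>0 < h < 1\<close>, hence have the same coefficients.
  Since the moments are nonnegative, Tonelli's theorem gives the expansion of the left-hand side for
  every \<open>h \<ge> 0\<close>, while the binomial series converges as long as \<open>P + Q (1 - h)\<close> stays positive;
  \<open>h = 1 + \<theta>\<close> is the claim.  The weight allows one variable of a pair to keep a fixed
  Laplace parameter while the parameter of the other is continued to negative values.
\<close>

lemma (in prob_space) mgf_from_laplace:
  fixes W X :: "'a \<Rightarrow> real"
  assumes [measurable]: "W \<in> borel_measurable M" "X \<in> borel_measurable M"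
    and W: "AE \<omega> in M. 0 \<le> W \<omega> \<and> W \<omega> \<le> 1" and X: "AE \<omega> in M. 0 \<le> X \<omega>"
    and pos: "\<And>s. 0 < s \<Longrightarrow> 0 < P + Q * s"
    and lap: "\<And>s. 0 < s \<Longrightarrow> (\<integral>\<omega>. W \<omega> * exp (- (s * X \<omega>)) \<partial>M) = (P + Q * s) powr (- \<alpha>)"
    and \<theta>: "0 < \<theta>" "Q * \<theta> < P"
  shows "(\<integral>\<^sup>+\<omega>. ennreal (W \<omega> * exp (\<theta> * X \<omega>)) \<partial>M) = ennreal ((P - Q * \<theta>) powr (- \<alpha>))"
proof -
  have Q: "0 \<le> Q"
  proof (rule ccontr)
    assume "\<not> 0 \<le> Q"
    then have "0 < P + Q * (\<bar>P\<bar> / (- Q) + 1)" by (intro pos add_nonneg_pos divide_nonneg_pos) auto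
    also have "\<dots> = P - \<bar>P\<bar> + Q" using \<open>\<not> 0 \<le> Q\<close> by (simp add: field_simps)
    finally show False using \<open>\<not> 0 \<le> Q\<close> by linarith
  qed
  have P: "0 < P" using Q \<theta> by (meson less_eq_real_def mult_nonneg_nonneg order.strict_trans1)
  define m where "m k = (\<integral>\<^sup>+\<omega>. ennreal (W \<omega> * exp (- X \<omega>) * X \<omega> ^ k / fact k) \<partial>M)" for k
  have expand: "(\<integral>\<^sup>+\<omega>. ennreal (W \<omega> * exp ((h - 1) * X \<omega>)) \<partial>M) = (\<Sum>k. m k * ennreal (h ^ k))"
    if h: "0 \<le> h" for h
  proof -
    have "(\<integral>\<^sup>+\<omega>. ennreal (W \<omega> * exp ((h - 1) * X \<omega>)) \<partial>M)
      = (\<integral>\<^sup>+\<omega>. (\<Sum>k. ennreal (W \<omega> * exp (- X \<omega>) * X \<omega> ^ k / fact k * h ^ k)) \<partial>M)"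
    proof (rule nn_integral_cong_AE)
      show "AE \<omega> in M. ennreal (W \<omega> * exp ((h - 1) * X \<omega>))
        = (\<Sum>k. ennreal (W \<omega> * exp (- X \<omega>) * X \<omega> ^ k / fact k * h ^ k))"
        using W X
      proof eventually_elim
        case (elim \<omega>)
        have "(\<lambda>k. (h * X \<omega>) ^ k /\<^sub>R fact k) sums exp (h * X \<omega>)" by (rule exp_converges)
        from sums_mult[OF this, of "W \<omega> * exp (- X \<omega>)"]
        have "(\<lambda>k. W \<omega> * exp (- X \<omega>) * X \<omega> ^ k / fact k * h ^ k) sums (W \<omega> * exp ((h - 1) * X \<omega>))"
          by (simp add: exp_diff exp_minus field_simps power_mult_distrib)
        then show ?case using elim h by (intro suminf_ennreal_eq[symmetric]) auto
      qed
    qed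
    also have "\<dots> = (\<Sum>k. (\<integral>\<^sup>+\<omega>. ennreal (W \<omega> * exp (- X \<omega>) * X \<omega> ^ k / fact k * h ^ k) \<partial>M))"
      by (rule nn_integral_suminf) measurable
    also have "\<dots> = (\<Sum>k. m k * ennreal (h ^ k))"
    proof (intro suminf_cong)
      fix k
      have "(\<integral>\<^sup>+\<omega>. ennreal (W \<omega> * exp (- X \<omega>) * X \<omega> ^ k / fact k * h ^ k) \<partial>M)
        = (\<integral>\<^sup>+\<omega>. ennreal (W \<omega> * exp (- X \<omega>) * X \<omega> ^ k / fact k) * ennreal (h ^ k) \<partial>M)"
        using W X by (intro nn_integral_cong_AE, eventually_elim)
          (subst ennreal_mult'[symmetric], use h in auto)
      then show "(\<integral>\<^sup>+\<omega>. ennreal (W \<omega> * exp (- X \<omega>) * X \<omega> ^ k / fact k * h ^ k) \<partial>M) = m k * ennreal (h ^ k)"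
        by (simp add: m_def nn_integral_multc)
    qed
    finally show ?thesis .
  qed
  have lap': "(\<Sum>k. m k * ennreal (h ^ k)) = ennreal ((P + Q * (1 - h)) powr (- \<alpha>))"
    if h: "0 < h" "h < 1" for h
  proof -
    have "integrable M (\<lambda>\<omega>. W \<omega> * exp (- ((1 - h) * X \<omega>)))"
    proof (rule integrable_const_bound[where B=1])
      show "AE \<omega> in M. norm (W \<omega> * exp (- ((1 - h) * X \<omega>))) \<le> 1"
        using W X by eventually_elim (use h in \<open>auto simp: abs_mult intro!: mult_le_one\<close>)
    qed measurable
    then have "(\<integral>\<^sup>+\<omega>. ennreal (W \<omega> * exp (- ((1 - h) * X \<omega>))) \<partial>M)
      = ennreal (\<integral>\<omega>. W \<omega> * exp (- ((1 - h) * X \<omega>)) \<partial>M)"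
      by (rule nn_integral_eq_integral) (use W in eventually_elim, auto)
    then show ?thesis using h lap[of "1 - h"] expand[of h] by (simp add: left_diff_distrib)
  qed
  have m_fin: "m k < \<infinity>" for k
  proof -
    have "m k * ennreal ((1/2) ^ k) \<le> (\<Sum>k. m k * ennreal ((1/2) ^ k))"
      using sum_le_suminf[of "\<lambda>k. m k * ennreal ((1/2) ^ k)" "{k}"] by simp
    also have "\<dots> < \<infinity>" by (subst lap') auto
    finally show ?thesis by (auto simp: ennreal_mult_less_top)
  qed
  define a where "a k = enn2real (m k)" for k
  have a: "m k = ennreal (a k)" "0 \<le> a k" for k using m_fin[of k] by (auto simp: a_def)
  define b where "b k = ((- \<alpha>) gchoose k) * (P + Q) powr (- \<alpha> - real k) * (- Q) ^ k" for k
  have b: "(\<lambda>k. b k * h ^ k) sums ((P + Q * (1 - h)) powr (- \<alpha>))" if "0 < h" "Q * h < P + Q" for h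
  proof -
    have "\<bar>- Q * h\<bar> < P + Q" using that Q by (simp add: abs_mult)
    from gen_binomial_real''[OF this, of "- \<alpha>"] show ?thesis
      by (simp add: b_def power_mult_distrib algebra_simps power_minus')
  qed
  \<comment> \<open>Only \<open>0 < h < 1\<close> is accessible from the Laplace transform, but that determines the coefficients.\<close>
  have "a k = b k" for k
  proof -
    have "(\<lambda>k. (a k - b k) * h ^ k) sums 0" if h: "0 < h" "h < 1" for h
    proof -
      have *: "(\<Sum>k. ennreal (a k * h ^ k)) = ennreal ((P + Q * (1 - h)) powr (- \<alpha>))"
        using lap'[OF h] h a by (simp add: ennreal_mult')
      then have "summable (\<lambda>k. a k * h ^ k)"
        by (intro summable_suminf_not_top) (use a h in auto)
      then have "(\<lambda>k. a k * h ^ k) sums ((P + Q * (1 - h)) powr (- \<alpha>))"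
        using * a h by (subst (asm) suminf_ennreal2) (auto simp: sums_iff suminf_nonneg)
      moreover have "Q * h < P + Q" using P Q h by (smt (verit) mult_left_le)
      ultimately show ?thesis using sums_diff b[of h] h by (fastforce simp: left_diff_distrib)
    qed
    then have "a k - b k = 0" by (intro power_series_eq_zero_on_right[of 1 "\<lambda>k. a k - b k"]) auto
    then show ?thesis by simp
  qed
  then have "(\<lambda>k. a k * (1 + \<theta>) ^ k) sums ((P - Q * \<theta>) powr (- \<alpha>))"
    using b[of "1 + \<theta>"] \<theta> by (simp add: algebra_simps)
  then have "(\<Sum>k. ennreal (a k * (1 + \<theta>) ^ k)) = ennreal ((P - Q * \<theta>) powr (- \<alpha>))"
    using a \<theta> by (intro suminf_ennreal_eq) auto
  then show ?thesis using expand[of "1 + \<theta>"] a \<theta> by (simp add: ennreal_mult')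
qed

section \<open>Pairs of values of a permanental process\<close>

lemma det_2:
  fixes A :: "'a :: comm_ring_1 mat"
  assumes "A \<in> carrier_mat 2 2"
  shows "Determinant.det A = A $$ (0,0) * A $$ (1,1) - A $$ (0,1) * A $$ (1,0)"
proof -
  have "Determinant.det A = (\<Sum>i<2. A $$ (i,0) * cofactor A i 0)"
    by (rule laplace_expansion_column[OF assms]) simp
  also have "\<dots> = A $$ (0,0) * A $$ (1,1) - A $$ (0,1) * A $$ (1,0)"
    using assms by (simp add: numeral_2_eq_2 cofactor_def det_single mat_delete_def)
  finally show ?thesis .
qed

text \<open>
  The Cauchy-Schwarz inequality in disguise.  If \<open>a, b, c\<close> are the variances and the covariance of
  \<open>G\<close> and \<open>H\<close>, then the factors on the right are the variances of \<open>G - H\<close> and of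
  \<open>G / sqrt r - sqrt r * H\<close>, and the left-hand side is the determinant of the covariance matrix of
  these two variables.  The difference of the two sides is therefore the square of their covariance.
\<close>

lemma gram_inequality:
  fixes a b c r :: real
  assumes "0 < r"
  shows "(a * b - c\<^sup>2) * (r - 1)\<^sup>2 / r \<le> (a + b - 2 * c) * (a / r + b * r - 2 * c)"
proof -
  have "(a + b - 2 * c) * (a + b * r\<^sup>2 - 2 * c * r) - (a * b - c\<^sup>2) * (r - 1)\<^sup>2
    = (a + b * r - c * (r + 1))\<^sup>2"
    by (simp add: power2_eq_square algebra_simps)
  then have "(a * b - c\<^sup>2) * (r - 1)\<^sup>2 \<le> (a + b - 2 * c) * (a + b * r\<^sup>2 - 2 * c * r)"
    by (smt (verit) zero_le_power2)
  then have "(a * b - c\<^sup>2) * (r - 1)\<^sup>2 / r \<le> (a + b - 2 * c) * (a + b * r\<^sup>2 - 2 * c * r) / r"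
    using assms by (simp add: divide_right_mono)
  also have "\<dots> = (a + b - 2 * c) * (a / r + b * r - 2 * c)"
    using assms by (simp add: field_simps power2_eq_square)
  finally show ?thesis .
qed

locale permanental = prob_space M for M :: "'a measure" +
  fixes \<alpha> :: real and T :: "'t set" and u :: "'t \<Rightarrow> 't \<Rightarrow> real" and X :: "'t \<Rightarrow> 'a \<Rightarrow> real"
  assumes \<alpha>: "0 < \<alpha>" and perm: "permanental_process M \<alpha> T u X"
begin

lemma one_point:
  assumes t: "t \<in> T"
  shows measurable_X: "X t \<in> borel_measurable M" and X_nonneg: "AE \<omega> in M. 0 \<le> X t \<omega>"
    and one_point_pos: "0 < s \<Longrightarrow> 0 < 1 + u t t * s"
    and one_point_laplace: "0 < s \<Longrightarrow> (\<integral>\<omega>. exp (- (s * X t \<omega>)) \<partial>M) = (1 + u t t * s) powr (- \<alpha>)"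
proof -
  have *: "permanental_vector M \<alpha> 1 (Matrix.mat 1 1 (\<lambda>(i, j). u t t)) (\<lambda>i. X t)"
    using perm t unfolding permanental_process_def by (elim allE[of _ 1] allE[of _ "\<lambda>_. t"]) auto
  then show "X t \<in> borel_measurable M" "AE \<omega> in M. 0 \<le> X t \<omega>"
    unfolding permanental_vector_def by auto
  have "Determinant.det (1\<^sub>m 1 + Matrix.mat 1 1 (\<lambda>(i, j). u t t) * mat_diag 1 (\<lambda>_. s)) = 1 + u t t * s"
    by (subst det_single) (auto simp: mat_diag_mult_right[of _ 1 1] simp del: One_nat_def)
  moreover have "0 < Determinant.det (1\<^sub>m 1 + Matrix.mat 1 1 (\<lambda>(i, j). u t t) * mat_diag 1 (\<lambda>_. s)) \<and>
     (\<integral>\<omega>. exp (- (s * X t \<omega>)) \<partial>M) =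
     Determinant.det (1\<^sub>m 1 + Matrix.mat 1 1 (\<lambda>(i, j). u t t) * mat_diag 1 (\<lambda>_. s)) powr (- \<alpha>)" if "0 < s"
    using * that unfolding permanental_vector_def by (auto dest: spec[of _ "\<lambda>_. s"])
  ultimately show "0 < s \<Longrightarrow> 0 < 1 + u t t * s"
     "0 < s \<Longrightarrow> (\<integral>\<omega>. exp (- (s * X t \<omega>)) \<partial>M) = (1 + u t t * s) powr (- \<alpha>)"
    by auto
qed

lemma two_point:
  assumes t: "t \<in> T" "s \<in> T" and x: "0 < x" "0 < y"
  defines "D \<equiv> (1 + u t t * x) * (1 + u s s * y) - u s t * u t s * x * y"
  shows two_point_pos: "0 < D"
    and two_point_laplace: "(\<integral>\<omega>. exp (- (x * X t \<omega> + y * X s \<omega>)) \<partial>M) = D powr (- \<alpha>)"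
proof -
  define p where "p i = (if i = 0 then t else s)" for i :: nat
  define q where "q i = (if i = 0 then x else y)" for i :: nat
  let ?U = "Matrix.mat 2 2 (\<lambda>(i, j). u (p i) (p j))"
  have "permanental_vector M \<alpha> 2 ?U (\<lambda>i. X (p i))"
    using perm t unfolding permanental_process_def
    by (elim allE[of _ 2] allE[of _ p]) (auto simp: p_def)
  moreover have "\<forall>i<2. 0 < q i" using x by (auto simp: q_def)
  ultimately have *: "0 < Determinant.det (1\<^sub>m 2 + ?U * mat_diag 2 q) \<and>
     (\<integral>\<omega>. exp (- (\<Sum>i<2. q i * X (p i) \<omega>)) \<partial>M) =
     Determinant.det (1\<^sub>m 2 + ?U * mat_diag 2 q) powr (- \<alpha>)"
    unfolding permanental_vector_def by blast
  have "Determinant.det (1\<^sub>m 2 + ?U * mat_diag 2 q) = D"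
    by (subst det_2) (auto simp: mat_diag_mult_right[of _ 2 2] p_def q_def D_def)
  moreover have "(\<Sum>i<2. q i * X (p i) \<omega>) = x * X t \<omega> + y * X s \<omega>" for \<omega>
    by (simp add: numeral_2_eq_2 p_def q_def)
  ultimately show "0 < D" "(\<integral>\<omega>. exp (- (x * X t \<omega> + y * X s \<omega>)) \<partial>M) = D powr (- \<alpha>)"
    using * by auto
qed

lemma kernel_diag_nonneg:
  assumes "t \<in> T"
  shows "0 \<le> u t t"
proof (rule ccontr)
  assume "\<not> 0 \<le> u t t"
  then show False using one_point_pos[OF assms, of "1 / - u t t"] by (simp add: field_simps)
qed

lemma one_point_mgf:
  assumes t: "t \<in> T" and "0 < \<theta>" "u t t * \<theta> < 1"
  shows "(\<integral>\<^sup>+\<omega>. ennreal (exp (\<theta> * X t \<omega>)) \<partial>M) = ennreal ((1 - u t t * \<theta>) powr (- \<alpha>))"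
  using mgf_from_laplace[of "\<lambda>_. 1" "X t" 1 "u t t" \<alpha> \<theta>] assms
    measurable_X[OF t] X_nonneg[OF t] one_point_pos[OF t] one_point_laplace[OF t]
  by simp

lemma two_point_mgf:
  assumes t: "t \<in> T" "s \<in> T" and "0 < \<theta>" "0 < \<tau>"
    and "(u t t + (u t t * u s s - u s t * u t s) * \<tau>) * \<theta> < 1 + u s s * \<tau>"
  shows "(\<integral>\<^sup>+\<omega>. ennreal (exp (\<theta> * X t \<omega> - \<tau> * X s \<omega>)) \<partial>M)
    = ennreal ((1 + u s s * \<tau> - (u t t + (u t t * u s s - u s t * u t s) * \<tau>) * \<theta>) powr (- \<alpha>))"
proof -
  note [measurable] = measurable_X[OF t(1)] measurable_X[OF t(2)]
  have D: "1 + u s s * \<tau> + (u t t + (u t t * u s s - u s t * u t s) * \<tau>) * x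
    = (1 + u t t * x) * (1 + u s s * \<tau>) - u s t * u t s * x * \<tau>" for x
    by (simp add: algebra_simps)
  have "(\<integral>\<^sup>+\<omega>. ennreal (exp (- (\<tau> * X s \<omega>)) * exp (\<theta> * X t \<omega>)) \<partial>M)
    = ennreal ((1 + u s s * \<tau> - (u t t + (u t t * u s s - u s t * u t s) * \<tau>) * \<theta>) powr (- \<alpha>))"
  proof (rule mgf_from_laplace)
    show "AE \<omega> in M. 0 \<le> exp (- (\<tau> * X s \<omega>)) \<and> exp (- (\<tau> * X s \<omega>)) \<le> 1"
      using X_nonneg[OF t(2)] by eventually_elim (use \<open>0 < \<tau>\<close> in auto)
    fix x :: real assume "0 < x"
    from two_point_pos[OF t this \<open>0 < \<tau>\<close>] two_point_laplace[OF t this \<open>0 < \<tau>\<close>]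
    show "0 < 1 + u s s * \<tau> + (u t t + (u t t * u s s - u s t * u t s) * \<tau>) * x"
      "(\<integral>\<omega>. exp (- (\<tau> * X s \<omega>)) * exp (- (x * X t \<omega>)) \<partial>M)
       = (1 + u s s * \<tau> + (u t t + (u t t * u s s - u s t * u t s) * \<tau>) * x) powr (- \<alpha>)"
      by (simp_all add: D exp_add[symmetric] add.commute)
  qed (use assms X_nonneg[OF t(1)] in auto)
  then show ?thesis by (simp add: exp_add[symmetric] algebra_simps)
qed

text \<open>
  Otherwise the determinant for Laplace parameters \<open>x = y\<close> has leading coefficient
  \<open>u t t * u s s - u s t * u t s < 0\<close> and becomes negative for large \<open>x\<close>.
\<close>

lemma kernel_prod_le:
  assumes t: "t \<in> T" "s \<in> T"
  shows "u s t * u t s \<le> u t t * u s s"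
proof (rule ccontr)
  assume gt: "\<not> ?thesis"
  define d where "d = u s t * u t s - u t t * u s s"
  have d: "0 < d" using gt by (simp add: d_def)
  define x where "x = (u t t + u s s + 1) / d + 1"
  note nn = kernel_diag_nonneg[OF t(1)] kernel_diag_nonneg[OF t(2)]
  have x: "1 \<le> x" using d nn by (simp add: x_def)
  then have "0 < (1 + u t t * x) * (1 + u s s * x) - u s t * u t s * x * x"
    by (intro two_point_pos[OF t]) auto
  also have "\<dots> = 1 + x * (u t t + u s s - d * x)"
    by (simp add: d_def algebra_simps)
  also have "u t t + u s s - d * x = - 1 - d"
    using d by (simp add: x_def field_simps)
  finally show False using x d by (smt (verit) mult_le_cancel_left1 mult_minus_right)
qed

text \<open>
  Weighting by \<open>exp (- X s)\<close> turns \<open>X t\<close> into a multiple of a Gamma variable with scale \<open>Q / P\<close>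
  in place of \<open>a = u t t\<close>.  A weight below \<open>1\<close> cannot make exponential moments infinite, so
  \<open>Q / P \<le> a\<close>, whereas \<open>u s t * u t s < 0\<close> would mean \<open>Q / P > a\<close>.
\<close>

lemma kernel_prod_nonneg:
  assumes t: "t \<in> T" "s \<in> T"
  shows "0 \<le> u s t * u t s"
proof (rule ccontr)
  assume neg: "\<not> ?thesis"
  define a b p where "a = u t t" and "b = u s s" and "p = u s t * u t s"
  define P Q where "P = 1 + b" and "Q = a + (a * b - p)"
  note [measurable] = measurable_X[OF t(1)] measurable_X[OF t(2)]
  have ab: "0 \<le> a" "0 \<le> b" using kernel_diag_nonneg t by (auto simp: a_def b_def)
  have p: "p < 0" using neg by (simp add: p_def)
  have PQ: "0 < P" "0 < Q" "a * P < Q"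
    using ab p mult_nonneg_nonneg[OF ab] unfolding P_def Q_def by (linarith, linarith, simp add: algebra_simps)
  have le: "1 - a * \<theta> \<le> P - Q * \<theta>" if \<theta>: "0 < \<theta>" "Q * \<theta> < P" for \<theta>
  proof -
    have a\<theta>: "a * \<theta> < 1"
    proof -
      have "a * \<theta> * P \<le> Q * \<theta>" using mult_right_mono[of "a * P" Q \<theta>] PQ \<theta> by (simp add: mult_ac)
      then have "a * \<theta> * P < 1 * P" using \<theta> by linarith
      then show ?thesis using PQ by (simp only: mult_less_cancel_right)
    qed
    have "ennreal ((P - Q * \<theta>) powr (- \<alpha>)) = (\<integral>\<^sup>+\<omega>. ennreal (exp (\<theta> * X t \<omega> - 1 * X s \<omega>)) \<partial>M)"
      using \<theta> by (subst two_point_mgf[OF t]) (auto simp: P_def Q_def a_def b_def p_def)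
    also have "\<dots> \<le> (\<integral>\<^sup>+\<omega>. ennreal (exp (\<theta> * X t \<omega>)) \<partial>M)"
      using X_nonneg[OF t(2)] by (intro nn_integral_mono_AE, eventually_elim) auto
    also have "\<dots> = ennreal ((1 - a * \<theta>) powr (- \<alpha>))"
      using \<theta> a\<theta> by (subst one_point_mgf[OF t(1)]) (auto simp: a_def)
    finally have "(P - Q * \<theta>) powr (- \<alpha>) \<le> (1 - a * \<theta>) powr (- \<alpha>)" by simp
    then show ?thesis
      using powr_less_mono2_neg[of "- \<alpha>" "P - Q * \<theta>" "1 - a * \<theta>"] \<alpha> \<theta> by force
  qed
  \<comment> \<open>Let \<open>\<theta>\<close> approach \<open>P / Q\<close>: the right-hand side of the inequality above tends to \<open>0\<close>, the
    left-hand side to \<open>g > 0\<close>.  A definite \<open>\<theta>\<close> close enough to \<open>P / Q\<close> suffices.\<close>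
  define g where "g = 1 - a * P / Q"
  have g: "0 < g" "g \<le> 1" using PQ ab by (auto simp: g_def field_simps)
  define e where "e = g / (2 * (P + 1))"
  have e: "0 < e" "e < 1" "P * e < g" using g PQ by (auto simp: e_def field_simps add_pos_pos)
  define \<theta> where "\<theta> = P / Q * (1 - e)"
  have "Q * \<theta> = P * (1 - e)" using PQ by (simp add: \<theta>_def)
  then have Q\<theta>: "Q * \<theta> = P - P * e" by (simp add: right_diff_distrib)
  have "0 < \<theta>" "Q * \<theta> < P" unfolding Q\<theta> using PQ e by (auto simp: \<theta>_def)
  from le[OF this] have "1 - a * \<theta> < g" using Q\<theta> e by simp
  moreover have "a * \<theta> \<le> a * (P / Q)"
    unfolding \<theta>_def using ab PQ e by (intro mult_left_mono mult_left_le) auto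
  ultimately show False by (simp add: g_def)
qed

text \<open>
  Since \<open>sqrt (u s t * u t s)\<close> is at most \<open>sqrt (u s s) * sqrt (u t t)\<close>, the expression under the
  root in \<open>sigma_fun\<close> dominates the square of \<open>sqrt (u t t) - sqrt (u s s)\<close>.
\<close>

lemma sigma_fun_facts:
  assumes t: "t \<in> T" "s \<in> T"
  shows sigma_fun_sq: "(sigma_fun u s t)\<^sup>2 = u s s + u t t - 2 * sqrt (u s t * u t s)"
    and sigma_fun_nonneg: "0 \<le> sigma_fun u s t"
    and sqrt_diag_le: "sqrt (u t t) \<le> sqrt (u s s) + sigma_fun u s t"
proof -
  note nn = kernel_diag_nonneg[OF t(1)] kernel_diag_nonneg[OF t(2)]
  have c: "sqrt (u s t * u t s) \<le> sqrt (u t t) * sqrt (u s s)"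
    using kernel_prod_le[OF t] by (simp flip: real_sqrt_mult)
  have sq: "(sqrt (u t t) - sqrt (u s s))\<^sup>2 \<le> u s s + u t t - 2 * sqrt (u s t * u t s)"
    using c nn by (simp add: power2_diff)
  then have nonneg: "0 \<le> u s s + u t t - 2 * sqrt (u s t * u t s)"
    by (rule order.trans[OF zero_le_power2])
  then show "(sigma_fun u s t)\<^sup>2 = u s s + u t t - 2 * sqrt (u s t * u t s)"
    and "0 \<le> sigma_fun u s t"
    by (simp_all add: sigma_fun_def)
  have "\<bar>sqrt (u t t) - sqrt (u s s)\<bar> \<le> sigma_fun u s t"
    unfolding sigma_fun_def by (rule real_le_rsqrt) (use sq in \<open>simp only: power2_abs\<close>)
  then show "sqrt (u t t) \<le> sqrt (u s s) + sigma_fun u s t" by linarith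
qed

text \<open>
  This replaces the Gaussian increment bound.  If \<open>X\<close> were half the square of a Gaussian process
  \<open>G\<close>, then \<open>\<eta> / (1 + \<eta>) * G t ^ 2 - \<eta> * G s ^ 2 \<le> (G t - G s) ^ 2\<close>, and the bound would be the
  exponential moment of the square of a Gaussian variable with variance \<open>\<sigma> ^ 2\<close>.  For every
  \<open>\<alpha>\<close> the claim amounts to the same comparison of the two bases of the powers, which reduces
  to \<open>gram_inequality\<close> with \<open>r = 1 + \<eta>\<close>.
\<close>

lemma two_point_mgf_increment:
  assumes t: "t \<in> T" "s \<in> T" and "0 < \<eta>" "0 < \<kappa>" "\<kappa> * (sigma_fun u s t)\<^sup>2 < 1"
  shows "(\<integral>\<^sup>+\<omega>. ennreal (exp (\<kappa> * (\<eta> / (1 + \<eta>) * X t \<omega> - \<eta> * X s \<omega>))) \<partial>M)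
     \<le> ennreal ((1 - \<kappa> * (sigma_fun u s t)\<^sup>2) powr (- \<alpha>))"
proof -
  define a b c where "a = u t t" and "b = u s s" and "c = sqrt (u s t * u t s)"
  have ab: "0 \<le> a" "0 \<le> b" using kernel_diag_nonneg t by (auto simp: a_def b_def)
  have c: "0 \<le> c" "c\<^sup>2 = u s t * u t s" using kernel_prod_nonneg[OF t] by (auto simp: c_def)
  have cab: "c\<^sup>2 \<le> a * b" using kernel_prod_le[OF t] c by (simp add: a_def b_def)
  have sig: "(sigma_fun u s t)\<^sup>2 = a + b - 2 * c"
    using sigma_fun_sq[OF t] by (simp add: a_def b_def c_def)
  define r where "r = 1 + \<eta>"
  define E where "E = 1 + b * (\<kappa> * \<eta>) - (a + (a * b - c\<^sup>2) * (\<kappa> * \<eta>)) * (\<kappa> * (\<eta> / r))"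
  have r: "1 < r" "\<eta> = r - 1" using assms by (auto simp: r_def)
  have "E - (1 - \<kappa> * (a + b - 2 * c))
     = \<kappa> * ((a / r + b * r - 2 * c) - \<kappa> * ((a * b - c\<^sup>2) * (r - 1)\<^sup>2 / r))"
    using r(1) unfolding E_def r(2) by (simp add: field_simps power2_eq_square)
  also have "0 \<le> \<dots>"
  proof -
    have nn: "0 \<le> a / r + b * r - 2 * c"
    proof -
      have "2 * c \<le> 2 * sqrt (a / r * (b * r))" unfolding c_def using r cab c by simp
      also have "\<dots> \<le> a / r + b * r" using arith_geo_mean_sqrt[of "a / r" "b * r"] ab r by simp
      finally show ?thesis by simp
    qed
    have "\<kappa> * ((a * b - c\<^sup>2) * (r - 1)\<^sup>2 / r) \<le> \<kappa> * ((a + b - 2 * c) * (a / r + b * r - 2 * c))"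
      using gram_inequality[of r a b c] r assms by (intro mult_left_mono) auto
    also have "\<dots> = (\<kappa> * (sigma_fun u s t)\<^sup>2) * (a / r + b * r - 2 * c)" by (simp add: sig)
    also have "\<dots> \<le> 1 * (a / r + b * r - 2 * c)"
      using assms nn by (intro mult_right_mono) auto
    finally show ?thesis using assms by simp
  qed
  finally have E: "1 - \<kappa> * (sigma_fun u s t)\<^sup>2 \<le> E" by (simp add: sig)
  have "(\<integral>\<^sup>+\<omega>. ennreal (exp (\<kappa> * (\<eta> / (1 + \<eta>) * X t \<omega> - \<eta> * X s \<omega>))) \<partial>M)
    = (\<integral>\<^sup>+\<omega>. ennreal (exp (\<kappa> * (\<eta> / r) * X t \<omega> - \<kappa> * \<eta> * X s \<omega>)) \<partial>M)"
    by (simp add: r_def algebra_simps)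
  also have "\<dots> = ennreal (E powr (- \<alpha>))"
    using E assms r by (subst two_point_mgf[OF t]) (auto simp: E_def a_def b_def c)
  also have "\<dots> \<le> ennreal ((1 - \<kappa> * (sigma_fun u s t)\<^sup>2) powr (- \<alpha>))"
    using E assms \<alpha> by (intro ennreal_leI powr_mono2') auto
  finally show ?thesis .
qed
end

section \<open>Tail estimates\<close>

lemma (in prob_space) chernoff_bound:
  assumes [measurable]: "Y \<in> borel_measurable M" and B: "0 \<le> B"
    and mgf: "(\<integral>\<^sup>+\<omega>. ennreal (exp (Y \<omega>)) \<partial>M) \<le> ennreal B"
  shows "prob {\<omega> \<in> space M. x < Y \<omega>} \<le> B * exp (- x)"
proof -
  have "emeasure M {\<omega> \<in> space M. x < Y \<omega>}
      \<le> emeasure M {\<omega> \<in> space M. 1 \<le> ennreal (exp (- x)) * ennreal (exp (Y \<omega>))}"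
    by (intro emeasure_mono) (auto simp flip: ennreal_mult' exp_add)
  also have "\<dots> \<le> ennreal (exp (- x)) * (\<integral>\<^sup>+\<omega>. ennreal (exp (Y \<omega>)) * indicator (space M) \<omega> \<partial>M)"
    by (rule nn_integral_Markov_inequality) auto
  also have "(\<integral>\<^sup>+\<omega>. ennreal (exp (Y \<omega>)) * indicator (space M) \<omega> \<partial>M) = (\<integral>\<^sup>+\<omega>. ennreal (exp (Y \<omega>)) \<partial>M)"
    by (intro nn_integral_cong) simp
  also have "ennreal (exp (- x)) * \<dots> \<le> ennreal (exp (- x)) * ennreal B"
    by (intro mult_left_mono mgf) simp
  also have "\<dots> = ennreal (B * exp (- x))" using B by (simp add: ennreal_mult' mult.commute)
  finally show ?thesis using B by (simp add: emeasure_eq_measure)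
qed

context permanental
begin

text \<open>
  The tail of a Gamma variable of scale at most \<open>v\<close>; \<open>\<gamma>\<close> may be taken as close to \<open>1\<close> as desired,
  which is what makes the constant in the main theorem equal to \<open>1\<close>.
\<close>

lemma one_point_tail:
  assumes t: "t \<in> T" and v: "u t t \<le> v" "0 < v" and \<gamma>: "0 < \<gamma>" "\<gamma> < 1"
  shows "prob {\<omega> \<in> space M. x * v < X t \<omega>} \<le> (1 - \<gamma>) powr (- \<alpha>) * exp (- \<gamma> * x)"
proof -
  note [measurable] = measurable_X[OF t]
  have le: "u t t * (\<gamma> / v) \<le> \<gamma>"
    using mult_right_mono[OF v(1), of "\<gamma> / v"] v \<gamma> by simp
  have "(\<integral>\<^sup>+\<omega>. ennreal (exp (\<gamma> / v * X t \<omega>)) \<partial>M) = ennreal ((1 - u t t * (\<gamma> / v)) powr (- \<alpha>))"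
    using v \<gamma> order.strict_trans1[OF le \<gamma>(2)] by (intro one_point_mgf[OF t]) auto
  also have "\<dots> \<le> ennreal ((1 - \<gamma>) powr (- \<alpha>))"
    using le \<gamma> \<alpha> by (intro ennreal_leI powr_mono2') auto
  finally have "prob {\<omega> \<in> space M. \<gamma> * x < \<gamma> / v * X t \<omega>} \<le> (1 - \<gamma>) powr (- \<alpha>) * exp (- (\<gamma> * x))"
    by (intro chernoff_bound) auto
  moreover have "\<gamma> * x < \<gamma> / v * X t \<omega> \<longleftrightarrow> x * v < X t \<omega>" for \<omega>
    using \<gamma> v by (simp add: field_simps)
  ultimately show ?thesis by simp
qed

text \<open>
  A one-sided increment bound stated multiplicatively.  The event means roughly that
  \<open>sqrt (X t)\<close> exceeds \<open>sqrt (X s)\<close> by \<open>\<eta> * sqrt L\<close> when \<open>X s\<close> is of order \<open>L\<close>.  Fixing \<open>\<eta>\<close> in advance keeps the event linear in \<open>X s\<close> and \<open>X t\<close>, so that one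
  exponential moment controls it, and only upward increments matter for an upper bound.
\<close>

lemma increment_tail:
  assumes t: "t \<in> T" "s \<in> T" and \<eta>: "0 < \<eta>" and \<psi>: "0 < \<psi>" "sigma_fun u s t \<le> \<psi>"
  shows "prob {\<omega> \<in> space M. (1 + \<eta>) * X s \<omega> + (1 + \<eta>) * \<eta> * L < X t \<omega>}
    \<le> 2 powr \<alpha> * exp (- (\<eta> / \<psi>)\<^sup>2 * L / 2)"
proof -
  note [measurable] = measurable_X[OF t(1)] measurable_X[OF t(2)]
  define \<kappa> where "\<kappa> = 1 / (2 * \<psi>\<^sup>2)"
  have \<kappa>: "0 < \<kappa>" using \<psi> by (simp add: \<kappa>_def)
  have "(sigma_fun u s t)\<^sup>2 \<le> \<psi>\<^sup>2" using \<psi> sigma_fun_nonneg[OF t] by (intro power_mono) auto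
  then have "\<kappa> * (sigma_fun u s t)\<^sup>2 \<le> \<kappa> * \<psi>\<^sup>2" using \<kappa> by (intro mult_left_mono) auto
  also have "\<kappa> * \<psi>\<^sup>2 = 1/2" using \<psi> by (simp add: \<kappa>_def)
  finally have half: "\<kappa> * (sigma_fun u s t)\<^sup>2 \<le> 1/2" .
  have "(\<integral>\<^sup>+\<omega>. ennreal (exp (\<kappa> * (\<eta> / (1 + \<eta>) * X t \<omega> - \<eta> * X s \<omega>))) \<partial>M)
     \<le> ennreal ((1 - \<kappa> * (sigma_fun u s t)\<^sup>2) powr (- \<alpha>))"
    using half by (intro two_point_mgf_increment[OF t \<eta> \<kappa>]) auto
  also have "\<dots> \<le> ennreal ((1/2) powr (- \<alpha>))"
    using half \<alpha> by (intro ennreal_leI powr_mono2') auto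
  also have "(1/2) powr (- \<alpha>) = 2 powr \<alpha>" by (simp add: powr_minus powr_divide)
  finally have "prob {\<omega> \<in> space M. \<kappa> * (\<eta>\<^sup>2 * L) < \<kappa> * (\<eta> / (1 + \<eta>) * X t \<omega> - \<eta> * X s \<omega>)}
     \<le> 2 powr \<alpha> * exp (- (\<kappa> * (\<eta>\<^sup>2 * L)))"
    by (intro chernoff_bound) auto
  moreover have "\<kappa> * (\<eta>\<^sup>2 * L) < \<kappa> * (\<eta> / (1 + \<eta>) * X t \<omega> - \<eta> * X s \<omega>)
    \<longleftrightarrow> (1 + \<eta>) * X s \<omega> + (1 + \<eta>) * \<eta> * L < X t \<omega>" for \<omega>
  proof -
    have "\<kappa> * (\<eta>\<^sup>2 * L) < \<kappa> * (\<eta> / (1 + \<eta>) * X t \<omega> - \<eta> * X s \<omega>)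
      \<longleftrightarrow> \<eta> * (\<eta> * L + X s \<omega>) < \<eta> * (X t \<omega> / (1 + \<eta>))"
      unfolding mult_less_cancel_left_pos[OF \<kappa>] by (simp add: algebra_simps power2_eq_square)
    also have "\<dots> \<longleftrightarrow> (\<eta> * L + X s \<omega>) * (1 + \<eta>) < X t \<omega>"
      using \<eta> by (simp add: pos_less_divide_eq)
    finally show ?thesis by (simp add: algebra_simps)
  qed
  moreover have "\<kappa> * (\<eta>\<^sup>2 * L) = (\<eta> / \<psi>)\<^sup>2 * L / 2"
    by (simp add: \<kappa>_def power_divide)
  ultimately show ?thesis by simp
qed

end

section \<open>Summability over double exponential scales\<close>

text \<open>
  On \<open>[(1/2) ^ 2 ^ (j + 1), (1/2) ^ 2 ^ j]\<close> the function \<open>\<phi>\<close> is at least its value at the left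
  endpoint, and the integral of \<open>1 / (x sqrt (ln (1 / x)))\<close>, whose antiderivative is
  \<open>- 2 sqrt (ln (1 / x))\<close>, is a constant times \<open>sqrt (2 ^ j)\<close>.  On scales shrinking only
  geometrically the sum that chaining requires could diverge.
\<close>

lemma double_exponential_scale_summable:
  fixes \<phi> :: "real \<Rightarrow> real"
  assumes mono: "mono_on {0..} \<phi>" and nonneg: "\<And>x. 0 \<le> x \<Longrightarrow> 0 \<le> \<phi> x"
    and int: "(\<integral>\<^sup>+x\<in>{0<..<1/2}. ennreal (\<phi> x / (x * sqrt (ln (1 / x)))) \<partial>lborel) < \<infinity>"
  shows "summable (\<lambda>j. \<phi> ((1/2) ^ (2 ^ j)) * sqrt (2 ^ j))"
proof -
  define \<delta> :: "nat \<Rightarrow> real" where "\<delta> j = (1/2) ^ (2 ^ j)" for j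
  define g :: "real \<Rightarrow> real" where "g x = 1 / (x * sqrt (- ln x))" for x
  define A where "A j = {\<delta> (Suc j)..<\<delta> j}" for j
  define c where "c = 2 * sqrt (ln 2) * (sqrt 2 - 1)"
  have \<delta>: "0 < \<delta> j" "\<delta> j \<le> 1/2" for j
    using power_decreasing[of 1 "2 ^ j" "1/2 :: real"] by (auto simp: \<delta>_def)
  have dec: "\<delta> j \<le> \<delta> i" if "i \<le> j" for i j
    unfolding \<delta>_def by (rule power_decreasing) (use that in auto)
  have ln\<delta>: "- ln (\<delta> j) = 2 ^ j * ln 2" for j by (simp add: \<delta>_def ln_realpow ln_div)
  have g_nonneg: "0 \<le> g x" if "0 < x" "x \<le> 1/2" for x
    using that by (auto simp: g_def)
  have [measurable]: "g \<in> borel_measurable borel" unfolding g_def by measurable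
  have int_g: "(\<integral>\<^sup>+x. ennreal (g x) * indicator (A j) x \<partial>lborel) = ennreal (c * sqrt (2 ^ j))" for j
  proof -
    have "(\<integral>\<^sup>+x. ennreal (g x) * indicator (A j) x \<partial>lborel)
      = (\<integral>\<^sup>+x. ennreal (g x) * indicator {\<delta> (Suc j)..\<delta> j} x \<partial>lborel)"
      using AE_lborel_singleton[of "\<delta> j"]
      by (intro nn_integral_cong_AE, eventually_elim) (auto simp: A_def indicator_def)
    also have "\<dots> = ennreal ((- 2 * sqrt (- ln (\<delta> j))) - (- 2 * sqrt (- ln (\<delta> (Suc j)))))"
    proof (rule nn_integral_FTC_Icc)
      fix x assume x: "x \<in> {\<delta> (Suc j)..\<delta> j}"
      then have x': "0 < x" "x < 1" using \<delta>[of "Suc j"] \<delta>[of j] unfolding atLeastAtMost_iff by linarith+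
      then show "((\<lambda>x. - 2 * sqrt (- ln x)) has_real_derivative g x) (at x)"
        unfolding g_def
        by (auto intro!: derivative_eq_intros simp: field_simps)
      show "0 \<le> g x" using x x' \<delta>[of j] by (intro g_nonneg) auto
    qed (use dec in auto)
    also have "(- 2 * sqrt (- ln (\<delta> j))) - (- 2 * sqrt (- ln (\<delta> (Suc j)))) = c * sqrt (2 ^ j)"
      by (simp add: ln\<delta> c_def real_sqrt_mult algebra_simps del: real_sqrt_power)
    finally show ?thesis .
  qed
  have c: "0 < c" by (simp add: c_def)
  define I where "I = (\<integral>\<^sup>+x\<in>{0<..<1/2}. ennreal (\<phi> x / (x * sqrt (ln (1 / x)))) \<partial>lborel)"
  have "(\<Sum>j<n. \<phi> (\<delta> (Suc j)) * (c * sqrt (2 ^ j))) \<le> enn2real I" for n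
  proof -
    have "ennreal (\<Sum>j<n. \<phi> (\<delta> (Suc j)) * (c * sqrt (2 ^ j)))
      = (\<Sum>j<n. ennreal (\<phi> (\<delta> (Suc j))) * (\<integral>\<^sup>+x. ennreal (g x) * indicator (A j) x \<partial>lborel))"
      using \<delta> nonneg c by (subst int_g) (auto simp: less_imp_le simp flip: ennreal_mult'' intro!: sum_ennreal[symmetric])
    also have "\<dots> = (\<integral>\<^sup>+x. (\<Sum>j<n. ennreal (\<phi> (\<delta> (Suc j))) * (ennreal (g x) * indicator (A j) x)) \<partial>lborel)"
      by (simp add: nn_integral_sum nn_integral_cmult A_def)
    also have "\<dots> \<le> I" unfolding I_def
    proof (rule nn_integral_mono)
      fix x
      show "(\<Sum>j<n. ennreal (\<phi> (\<delta> (Suc j))) * (ennreal (g x) * indicator (A j) x))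
        \<le> ennreal (\<phi> x / (x * sqrt (ln (1 / x)))) * indicator {0<..<1/2} x"
      proof (cases "\<exists>k<n. x \<in> A k")
        case True
        then obtain k where k: "k < n" "x \<in> A k" by blast
        then have x: "0 < x" "x < 1/2" "\<delta> (Suc k) \<le> x"
          using \<delta>[of "Suc k"] \<delta>[of k] by (auto simp: A_def)
        have "x \<notin> A j" if "j \<noteq> k" for j
          using that k(2) dec[of "Suc j" k] dec[of "Suc k" j]
          by (cases j k rule: linorder_cases) (auto simp: A_def Suc_le_eq)
        then have "(\<Sum>j<n. ennreal (\<phi> (\<delta> (Suc j))) * (ennreal (g x) * indicator (A j) x))
          = (\<Sum>j<n. if j = k then ennreal (\<phi> (\<delta> (Suc k))) * ennreal (g x) else 0)"
          using k by (intro sum.cong) auto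
        also have "\<dots> = ennreal (\<phi> (\<delta> (Suc k)) * g x)"
          using k nonneg[of "\<delta> (Suc k)"] \<delta>(1)[of "Suc k"] by (simp add: ennreal_mult')
        also have "\<dots> \<le> ennreal (\<phi> x * g x)"
          using x \<delta>(1)[of "Suc k"] g_nonneg[of x]
          by (intro ennreal_leI mult_right_mono mono_onD[OF mono]) auto
        also have "\<dots> = ennreal (\<phi> x / (x * sqrt (ln (1 / x)))) * indicator {0<..<1/2} x"
          using x by (simp add: g_def ln_div)
        finally show ?thesis .
      qed auto
    qed
    finally have "enn2real (ennreal (\<Sum>j<n. \<phi> (\<delta> (Suc j)) * (c * sqrt (2 ^ j)))) \<le> enn2real I"
      using int by (intro enn2real_mono) (auto simp: I_def)
    moreover have "0 \<le> (\<Sum>j<n. \<phi> (\<delta> (Suc j)) * (c * sqrt (2 ^ j)))"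
      using \<delta> nonneg c by (intro sum_nonneg mult_nonneg_nonneg) (auto simp: less_imp_le)
    ultimately show ?thesis by simp
  qed
  then have "summable (\<lambda>j. \<phi> (\<delta> (Suc j)) * (c * sqrt (2 ^ j)))"
    by (intro summableI_nonneg_bounded) (use \<delta> nonneg c in \<open>auto simp: less_imp_le\<close>)
  then have "summable (\<lambda>j. sqrt 2 / c * (\<phi> (\<delta> (Suc j)) * (c * sqrt (2 ^ j))))"
    by (rule summable_mult)
  also have "(\<lambda>j. sqrt 2 / c * (\<phi> (\<delta> (Suc j)) * (c * sqrt (2 ^ j)))) = (\<lambda>j. \<phi> (\<delta> (Suc j)) * sqrt (2 ^ Suc j))"
    using c by (auto simp: real_sqrt_mult)
  finally show ?thesis by (subst (asm) summable_Suc_iff) (simp add: \<delta>_def)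
qed

text \<open>
  Adding \<open>L\<close> to both sides makes the recursion homogeneous: each step multiplies \<open>x + L\<close> by at
  most \<open>(1 + \<eta>) ^ 2\<close>.
\<close>

lemma chain_bound:
  fixes x \<eta> :: "nat \<Rightarrow> real"
  assumes step: "\<And>j. p \<le> j \<Longrightarrow> x (Suc j) \<le> (1 + \<eta> j) * x j + (1 + \<eta> j) * \<eta> j * L"
    and nonneg: "\<And>j. 0 \<le> x j" "\<And>j. 0 \<le> \<eta> j" "0 \<le> L"
    and "p \<le> j"
  shows "x j + L \<le> exp (2 * (\<Sum>i=p..<j. \<eta> i)) * (x p + L)"
  using \<open>p \<le> j\<close>
proof (induction j rule: dec_induct)
  case (step j)
  have "x (Suc j) + L \<le> (1 + \<eta> j) * x j + (1 + \<eta> j) * \<eta> j * L + L"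
    using assms(1)[OF step(1)] by simp
  also have "\<dots> \<le> (1 + \<eta> j)\<^sup>2 * (x j + L)"
    using nonneg(1)[of j] nonneg(2)[of j] nonneg(3)
    by (simp add: power2_eq_square algebra_simps add_nonneg_nonneg)
  also have "\<dots> \<le> (exp (\<eta> j))\<^sup>2 * (x j + L)"
    using nonneg(1)[of j] nonneg(2)[of j] nonneg(3) exp_ge_add_one_self[of "\<eta> j"]
    by (intro mult_right_mono power_mono) auto
  also have "\<dots> \<le> (exp (\<eta> j))\<^sup>2 * (exp (2 * (\<Sum>i=p..<j. \<eta> i)) * (x p + L))"
    by (intro mult_left_mono step.IH) auto
  also have "\<dots> = exp (2 * (\<Sum>i=p..<Suc j. \<eta> i)) * (x p + L)"
    using step(1) by (simp add: exp_add[symmetric] exp_double[symmetric] distrib_left add.commute mult.assoc[symmetric] del: exp_double)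
  finally show ?case .
qed auto

section \<open>Borel-Cantelli along nested grids\<close>

text \<open>
  The first Borel-Cantelli lemma applied to the unions over \<open>j\<close>; the product bound makes the double
  sum over \<open>n\<close> and \<open>j\<close> finite.
\<close>

lemma (in prob_space) AE_eventually_notin:
  assumes [measurable]: "\<And>n j. A n j \<in> events"
    and le: "\<And>n j. m \<le> n \<Longrightarrow> prob (A n j) \<le> b n * c j"
    and b: "summable b" and c: "summable c"
  shows "AE \<omega> in M. \<forall>\<^sub>F n in sequentially. \<forall>j::nat. \<omega> \<notin> A n j"
proof -
  have union: "prob (\<Union>j. A n j) \<le> b n * suminf c" if "m \<le> n" for n
  proof -
    have s: "summable (\<lambda>j. prob (A n j))"
      by (rule summable_comparison_test'[OF summable_mult[OF c, of "b n"]]) (use le[OF that] in auto)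
    have "prob (\<Union>j. A n j) \<le> (\<Sum>j. prob (A n j))"
      by (rule finite_measure_subadditive_countably[OF _ s]) auto
    also have "\<dots> \<le> (\<Sum>j. b n * c j)"
      by (rule suminf_le[OF le[OF that] s summable_mult[OF c]])
    finally show ?thesis by (simp add: suminf_mult[OF c])
  qed
  have "AE \<omega> in M. \<forall>\<^sub>F n in sequentially. \<omega> \<in> space M - (\<Union>j. A n j)"
  proof (rule borel_cantelli_AE1)
    show "summable (\<lambda>n. prob (\<Union>j. A n j))"
      by (rule summable_comparison_test'[OF summable_mult2[OF b, of "suminf c"], of m])
        (use union in auto)
  qed (auto simp: emeasure_eq_measure)
  then show ?thesis by eventually_elim (auto elim: eventually_mono)
qed

text \<open>
  Squaring the number of grid points per unit interval from one level to the next keeps the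
  logarithm of the number of links comparable to \<open>2 ^ j\<close> while the spacing follows the scales on which the integral condition is summable.
\<close>

definition mesh :: "nat \<Rightarrow> nat" where
  "mesh j = 2 ^ (2 ^ j)"

definition grid :: "nat \<Rightarrow> nat \<Rightarrow> nat \<Rightarrow> real" where
  "grid n j i = real n + real i / real (mesh j)"

lemma mesh_pos [simp]: "0 < mesh j" "mesh j \<noteq> 0" by (simp_all add: mesh_def)

lemma mesh_le_exp: "real (mesh j) \<le> exp (2 ^ j)"
proof -
  have "real (mesh j) = 2 ^ (2 ^ j)" by (simp add: mesh_def)
  also have "\<dots> \<le> exp 1 ^ (2 ^ j)" using exp_ge_add_one_self[of 1] by (intro power_mono) auto
  also have "\<dots> = exp (2 ^ j)" by (simp flip: exp_of_nat_mult)
  finally show ?thesis .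
qed

lemma mesh_tendsto: "(\<lambda>j. 1 / real (mesh j)) \<longlonglongrightarrow> 0"
proof (rule tendsto_sandwich[OF _ _ tendsto_const])
  show "\<forall>\<^sub>F j in sequentially. 1 / real (mesh j) \<le> (1/2) ^ j"
  proof (intro always_eventually allI)
    fix j :: nat
    have "(2::real) ^ j \<le> 2 ^ (2 ^ j)" by (intro power_increasing) (auto simp: less_imp_le)
    then show "1 / real (mesh j) \<le> (1/2) ^ j" by (simp add: mesh_def field_simps)
  qed
  show "(\<lambda>j. (1/2 :: real) ^ j) \<longlonglongrightarrow> 0" by (rule LIMSEQ_realpow_zero) auto
qed auto

lemma grid_below:
  assumes t: "real n \<le> t" "t < real n + 1"
  shows "\<exists>k. k < mesh j \<and> grid n j k \<le> t \<and> t < grid n j k + 1 / mesh j"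
proof -
  define k where "k = nat \<lfloor>(t - n) * mesh j\<rfloor>"
  have nn: "0 \<le> (t - n) * mesh j" using t by simp
  have le: "real k \<le> (t - n) * mesh j" and lt: "(t - n) * mesh j < real k + 1"
    using nn unfolding k_def by (auto simp: of_nat_nat floor_less_iff)
  have "(t - n) * mesh j < 1 * real (mesh j)" using t by (intro mult_strict_right_mono) auto
  then have "k < mesh j" using le by linarith
  moreover have "grid n j k \<le> t" "t < grid n j k + 1 / mesh j"
    using le lt by (auto simp: grid_def field_simps)
  ultimately show ?thesis by (intro exI[of _ k]) auto
qed

lemma summable_nat_powr: "x < -1 \<Longrightarrow> summable (\<lambda>n. real n powr x)"
  by (simp add: summable_real_powr_iff)

locale real_permanental = permanental M \<alpha> "{0..}" u X
  for M :: "'a measure" and \<alpha> :: real and u :: "real \<Rightarrow> real \<Rightarrow> real" and X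
begin

lemma grid_in [simp]: "grid n j i \<in> {0..}" by (simp add: grid_def)

text \<open>
  The choice of \<open>\<eta>\<close> makes each link between levels \<open>j\<close> and \<open>j + 1\<close> of \<open>[n, n + 1)\<close> fail with
  probability of order \<open>exp (- 8 * 2 ^ j * ln n)\<close>.  There are at most \<open>exp (3 * 2 ^ j)\<close> links, so the
  failure probabilities are summable over all links, levels and unit intervals.
\<close>

lemma AE_eventually_links:
  assumes \<psi>: "\<And>j. 0 < \<psi> j"
    and sig: "\<And>j s t. 0 \<le> s \<Longrightarrow> 0 \<le> t \<Longrightarrow> \<bar>t - s\<bar> \<le> 1 / mesh j \<Longrightarrow> sigma_fun u s t \<le> \<psi> j"
    and \<eta>: "\<And>j. \<eta> j = 4 * sqrt (2 ^ j) * \<psi> j"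
  shows "AE \<omega> in M. \<forall>\<^sub>F n in sequentially. \<forall>j. \<forall>i<mesh j. \<forall>k<mesh (Suc j).
    \<bar>grid n (Suc j) k - grid n j i\<bar> \<le> 1 / mesh j \<longrightarrow>
    X (grid n (Suc j) k) \<omega> \<le> (1 + \<eta> j) * X (grid n j i) \<omega> + (1 + \<eta> j) * \<eta> j * ln n"
proof -
  note [measurable] = measurable_X[OF grid_in]
  define I where "I n j = {(i, k). i < mesh j \<and> k < mesh (Suc j) \<and>
    \<bar>grid n (Suc j) k - grid n j i\<bar> \<le> 1 / mesh j}" for n j
  define B where "B n j = (\<lambda>(i, k). {\<omega> \<in> space M.
    (1 + \<eta> j) * X (grid n j i) \<omega> + (1 + \<eta> j) * \<eta> j * ln n < X (grid n (Suc j) k) \<omega>})" for n j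
  have I_sub: "I n j \<subseteq> {..<mesh j} \<times> {..<mesh (Suc j)}" for n j by (auto simp: I_def)
  then have I_fin: "finite (I n j)" for n j by (rule finite_subset) auto
  have I_card: "real (card (I n j)) \<le> real (mesh j) * real (mesh (Suc j))" for n j
    using card_mono[OF _ I_sub[of n j]] by (simp add: card_cartesian_product flip: of_nat_mult)
  have [measurable]: "B n j x \<in> events" for n j x
    unfolding B_def by (cases x) simp
  have \<eta>_pos: "0 < \<eta> j" for j using \<psi>[of j] by (simp add: \<eta>)
  have "AE \<omega> in M. \<forall>\<^sub>F n in sequentially. \<forall>j. \<omega> \<notin> (\<Union>x\<in>I n j. B n j x)"
  proof (rule AE_eventually_notin)
    show "(\<Union>x\<in>I n j. B n j x) \<in> events" for n j using I_fin by (intro sets.finite_UN) auto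
    show "summable (\<lambda>n. 2 powr \<alpha> * real n powr (-2))"
      by (intro summable_mult summable_nat_powr) simp
    show "summable (\<lambda>j. exp (-1) ^ j :: real)" by (intro summable_geometric) simp
    \<comment> \<open>From \<open>n = 3\<close> on, \<open>ln n \<ge> 1\<close>, so \<open>exp (3 * 2 ^ j)\<close> is absorbed by the tail.\<close>
    fix n j :: nat assume n: "3 \<le> n"
    have L: "1 \<le> ln (real n)"
      using n e_less_272 by (subst ln_ge_iff) auto
    have "prob (\<Union>x\<in>I n j. B n j x) \<le> (\<Sum>x\<in>I n j. prob (B n j x))"
      using I_fin by (intro finite_measure_subadditive_finite) auto
    also have "\<dots> \<le> (\<Sum>x\<in>I n j. 2 powr \<alpha> * exp (- (8 * 2 ^ j * ln n)))"
    proof (rule sum_mono)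
      fix x assume "x \<in> I n j"
      then obtain i k where x: "x = (i, k)" "\<bar>grid n (Suc j) k - grid n j i\<bar> \<le> 1 / mesh j"
        by (auto simp: I_def)
      have "prob (B n j x) \<le> 2 powr \<alpha> * exp (- (\<eta> j / \<psi> j)\<^sup>2 * ln n / 2)"
        unfolding B_def x prod.case using x(2) grid_in[of n j i] grid_in[of n "Suc j" k]
        by (intro increment_tail sig \<psi> \<eta>_pos) auto
      also have "(\<eta> j / \<psi> j)\<^sup>2 = 16 * 2 ^ j"
        using \<psi>[of j] by (simp add: \<eta> power_mult_distrib)
      finally show "prob (B n j x) \<le> 2 powr \<alpha> * exp (- (8 * 2 ^ j * ln n))" by (simp add: mult_ac)
    qed
    also have "\<dots> = real (card (I n j)) * (2 powr \<alpha> * exp (- (8 * 2 ^ j * ln n)))" by simp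
    also have "\<dots> \<le> exp (3 * 2 ^ j) * (2 powr \<alpha> * exp (- (8 * 2 ^ j * ln n)))"
    proof (rule mult_right_mono)
      have "real (mesh j) * real (mesh (Suc j)) \<le> exp (2 ^ j) * exp (2 ^ Suc j)"
        by (intro mult_mono mesh_le_exp) auto
      also have "\<dots> = exp (3 * 2 ^ j)" by (simp flip: exp_add)
      finally show "real (card (I n j)) \<le> exp (3 * 2 ^ j)" using I_card[of n j] by linarith
    qed auto
    also have "\<dots> = 2 powr \<alpha> * exp (3 * 2 ^ j - 8 * 2 ^ j * ln n)"
      by (simp add: exp_diff exp_minus field_simps)
    also have "\<dots> \<le> 2 powr \<alpha> * exp (- 2 * ln n - j)"
    proof -
      have "real j + 1 \<le> 2 ^ j" by (induction j) auto
      then have "(real j + 1) * ln n \<le> 2 ^ j * ln n" using L by (intro mult_right_mono) auto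
      moreover have "2 ^ j * 1 \<le> 2 ^ j * ln n" using L by (intro mult_left_mono) auto
      moreover have "real j * 1 \<le> real j * ln n" using L by (intro mult_left_mono) auto
      ultimately have "3 * 2 ^ j - 8 * 2 ^ j * ln n \<le> - 2 * ln n - j"
        using L unfolding distrib_right mult_1 mult_1_right mult.assoc by linarith
      then show ?thesis by simp
    qed
    also have "\<dots> = 2 powr \<alpha> * real n powr (-2) * exp (-1) ^ j"
      using n by (simp add: powr_def exp_diff exp_minus field_simps flip: exp_of_nat_mult)
    finally show "prob (\<Union>x\<in>I n j. B n j x) \<le> 2 powr \<alpha> * real n powr (-2) * exp (-1) ^ j" .
  qed
  moreover have "AE \<omega> in M. \<omega> \<in> space M" by simp
  ultimately show ?thesis
  proof eventually_elim
    case (elim \<omega>)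
    from elim(1) show ?case
      by (rule eventually_mono) (use elim(2) in \<open>fastforce simp: I_def B_def not_less\<close>)
  qed
qed

text \<open>
  On the starting level there are boundedly many points per unit interval, and each fails with
  probability of order \<open>n powr - (1 + \<epsilon> / 2)\<close>.  This is where the logarithm and its
  constant come from.
\<close>

lemma AE_eventually_base:
  assumes v: "\<And>t. 1 \<le> t \<Longrightarrow> u t t \<le> v t" "\<And>t. 1 \<le> t \<Longrightarrow> 0 < v t" and \<epsilon>: "0 < \<epsilon>"
  shows "AE \<omega> in M. \<forall>\<^sub>F n in sequentially. \<forall>i<mesh p.
    X (grid n p i) \<omega> \<le> (1 + \<epsilon>) * ln n * v (grid n p i)"
proof -
  note [measurable] = measurable_X[OF grid_in]
  define B where "B n i = {\<omega> \<in> space M. (1 + \<epsilon>) * ln n * v (grid n p i) < X (grid n p i) \<omega>}" for n i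
  have [measurable]: "B n i \<in> events" for n i unfolding B_def by simp
  define \<gamma> where "\<gamma> = (1 + \<epsilon> / 2) / (1 + \<epsilon>)"
  have \<gamma>: "0 < \<gamma>" "\<gamma> < 1" "\<gamma> * (1 + \<epsilon>) = 1 + \<epsilon> / 2" using \<epsilon> by (auto simp: \<gamma>_def field_simps)
  have le: "prob (\<Union>i<mesh p. B n i) \<le> mesh p * (1 - \<gamma>) powr (- \<alpha>) * real n powr (- (1 + \<epsilon> / 2))"
    if n: "1 \<le> n" for n
  proof -
    have "prob (\<Union>i<mesh p. B n i) \<le> (\<Sum>i<mesh p. prob (B n i))"
      by (intro finite_measure_subadditive_finite) auto
    also have "\<dots> \<le> (\<Sum>i<mesh p. (1 - \<gamma>) powr (- \<alpha>) * real n powr (- (1 + \<epsilon> / 2)))"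
    proof (rule sum_mono)
      fix i
      have "1 \<le> grid n p i" using n by (simp add: grid_def add_increasing2)
      from one_point_tail[OF grid_in v[OF this] \<gamma>(1,2), of "(1 + \<epsilon>) * ln n"]
      have "prob (B n i) \<le> (1 - \<gamma>) powr (- \<alpha>) * exp (- (\<gamma> * (1 + \<epsilon>)) * ln n)"
        by (simp add: B_def mult.assoc)
      also have "exp (- (\<gamma> * (1 + \<epsilon>)) * ln n) = real n powr (- (1 + \<epsilon> / 2))"
        unfolding \<gamma>(3) using n by (simp add: powr_def)
      finally show "prob (B n i) \<le> (1 - \<gamma>) powr (- \<alpha>) * real n powr (- (1 + \<epsilon> / 2))" .
    qed
    finally show ?thesis by simp
  qed
  have "AE \<omega> in M. \<forall>\<^sub>F n in sequentially. \<omega> \<in> space M - (\<Union>i<mesh p. B n i)"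
  proof (rule borel_cantelli_AE1)
    show "summable (\<lambda>n. prob (\<Union>i<mesh p. B n i))"
    proof (rule summable_comparison_test'[of _ 1])
      show "summable (\<lambda>n. mesh p * (1 - \<gamma>) powr (- \<alpha>) * real n powr (- (1 + \<epsilon> / 2)))"
        using \<epsilon> by (intro summable_mult summable_nat_powr) simp
    qed (use le in auto)
  qed (auto simp: emeasure_eq_measure)
  then show ?thesis
    by eventually_elim (auto elim!: eventually_mono simp: B_def not_less)
qed

text \<open>
  The chain runs through the largest grid points below \<open>t\<close>.  Approaching \<open>t\<close> from the left
  guarantees that the starting point lies in \<open>[0, t]\<close>, so that \<open>u\<close> there is controlled by the
  running supremum at \<open>t\<close>.
\<close>

lemma sup_bound_from_grid:
  fixes x :: "real \<Rightarrow> real" and \<eta> :: "nat \<Rightarrow> real"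
  assumes cont: "continuous_on {0..} x" and nonneg: "\<And>j i. 0 \<le> x (grid n j i)"
    and \<eta>: "\<And>j. 0 \<le> \<eta> j" "summable \<eta>" and L: "0 \<le> L"
    and link: "\<And>j i k. i < mesh j \<Longrightarrow> k < mesh (Suc j) \<Longrightarrow>
      \<bar>grid n (Suc j) k - grid n j i\<bar> \<le> 1 / mesh j \<Longrightarrow>
      x (grid n (Suc j) k) \<le> (1 + \<eta> j) * x (grid n j i) + (1 + \<eta> j) * \<eta> j * L"
    and base: "\<And>i. i < mesh p \<Longrightarrow> grid n p i \<le> t \<Longrightarrow> x (grid n p i) \<le> C"
    and t: "real n \<le> t" "t < real n + 1"
  shows "x t + L \<le> exp (2 * (\<Sum>j. \<eta> (j + p))) * (C + L)"
proof -
  obtain k where k: "\<And>j. k j < mesh j" "\<And>j. grid n j (k j) \<le> t"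
      "\<And>j. t < grid n j (k j) + 1 / mesh j"
    using grid_below[OF t] by metis
  define q where "q j = grid n j (k j)" for j
  have q_lim: "q \<longlonglongrightarrow> t"
  proof (rule tendsto_sandwich)
    show "(\<lambda>j. t - 1 / mesh j) \<longlonglongrightarrow> t"
      using tendsto_diff[OF tendsto_const mesh_tendsto, of t] by simp
    show "\<forall>\<^sub>F j in sequentially. t - 1 / mesh j \<le> q j"
      using k(3) by (intro always_eventually allI) (simp add: q_def less_imp_le algebra_simps)
    show "\<forall>\<^sub>F j in sequentially. q j \<le> t" using k(2) by (simp add: q_def)
  qed simp
  have "(\<lambda>j. x (q j)) \<longlonglongrightarrow> x t"
    using cont q_lim by (rule continuous_on_tendsto_compose) (use t in \<open>auto simp: q_def grid_def\<close>)
  then have lim: "(\<lambda>j. x (q j) + L) \<longlonglongrightarrow> x t + L" by (intro tendsto_intros)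
  have mesh_mono: "1 / real (mesh (Suc j)) \<le> 1 / mesh j" for j
    by (intro divide_left_mono) (auto simp: mesh_def intro!: power_increasing)
  have "x (q j) + L \<le> exp (2 * (\<Sum>j. \<eta> (j + p))) * (C + L)" if "p \<le> j" for j
  proof -
    have "x (q j) + L \<le> exp (2 * (\<Sum>i=p..<j. \<eta> i)) * (x (q p) + L)"
    proof (rule chain_bound[OF _ _ \<eta>(1) L that])
      fix j
      show "0 \<le> x (q j)" using nonneg by (simp add: q_def)
      have "\<bar>q (Suc j) - q j\<bar> \<le> 1 / mesh j"
        using k(2)[of j] k(3)[of j] k(2)[of "Suc j"] k(3)[of "Suc j"] mesh_mono[of j]
        unfolding q_def by linarith
      then show "x (q (Suc j)) \<le> (1 + \<eta> j) * x (q j) + (1 + \<eta> j) * \<eta> j * L"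
        unfolding q_def by (intro link k(1))
    qed
    also have "\<dots> \<le> exp (2 * (\<Sum>j. \<eta> (j + p))) * (C + L)"
    proof (intro mult_mono)
      have "(\<Sum>i=p..<j. \<eta> i) = (\<Sum>i<j - p. \<eta> (i + p))"
        using sum.shift_bounds_nat_ivl[of \<eta> 0 p "j - p"] that by (simp add: atLeast0LessThan)
      also have "\<dots> \<le> (\<Sum>j. \<eta> (j + p))"
        using \<eta> by (intro sum_le_suminf) (auto simp: summable_iff_shift)
      finally show "exp (2 * (\<Sum>i=p..<j. \<eta> i)) \<le> exp (2 * (\<Sum>j. \<eta> (j + p)))" by simp
      show "x (q p) + L \<le> C + L" using base k by (simp add: q_def)
      show "0 \<le> x (q p) + L" using nonneg L by (simp add: q_def)
    qed auto
    finally show ?thesis .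
  qed
  then show ?thesis by (intro LIMSEQ_le_const2[OF lim]) auto
qed

end

section \<open>The upper limit\<close>

lemma summable_dyadic_half_power: "summable (\<lambda>j. (1/2) ^ j * sqrt (2 ^ j) :: real)"
proof -
  have "(1/2) ^ j * sqrt (2 ^ j) = (sqrt 2 / 2) ^ j" for j
    by (simp add: real_sqrt_power power_divide)
  moreover have "summable (\<lambda>j. (sqrt 2 / 2) ^ j)"
    by (intro summable_geometric) (simp add: real_less_lsqrt)
  ultimately show ?thesis by simp
qed

context real_permanental
begin

text \<open>
  The increment bound on \<open>sqrt (u s s)\<close> makes \<open>s \<mapsto> u s s\<close> bounded on \<open>[0, t]\<close>; hence the
  running supremum, taken in the reals, is a genuine one.
\<close>

lemma ustar_facts:
  assumes mono: "mono_on {0..} \<phi>"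
    and sig: "\<And>s t. 0 \<le> s \<Longrightarrow> 0 \<le> t \<Longrightarrow> sigma_fun u s t \<le> \<phi> \<bar>t - s\<bar>"
  shows diag_le_ustar: "0 \<le> s \<Longrightarrow> s \<le> t \<Longrightarrow> u s s \<le> ustar u t"
    and ustar_mono: "0 \<le> s \<Longrightarrow> s \<le> t \<Longrightarrow> ustar u s \<le> ustar u t"
proof -
  have bdd: "bdd_above ((\<lambda>s. u s s) ` {0..t})" for t
  proof (rule bdd_aboveI2)
    fix s assume s: "s \<in> {0..t}"
    have "sqrt (u s s) \<le> sqrt (u 0 0) + sigma_fun u 0 s"
      using s by (intro sqrt_diag_le) auto
    also have "sigma_fun u 0 s \<le> \<phi> t"
      using sig[of 0 s] mono_onD[OF mono, of s t] s by auto
    finally have "(sqrt (u s s))\<^sup>2 \<le> (sqrt (u 0 0) + \<phi> t)\<^sup>2"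
      using kernel_diag_nonneg[of s] s by (intro power_mono) auto
    then show "u s s \<le> (sqrt (u 0 0) + \<phi> t)\<^sup>2"
      using kernel_diag_nonneg[of s] s by simp
  qed
  show "u s s \<le> ustar u t" if "0 \<le> s" "s \<le> t"
    unfolding ustar_def using that by (intro cSUP_upper bdd) auto
  show "ustar u s \<le> ustar u t" if "0 \<le> s" "s \<le> t"
    unfolding ustar_def using that by (intro cSUP_subset_mono bdd) auto
qed

end

theorem theorem1p4:
  fixes M :: "'a measure"
    and \<alpha> :: real
    and X :: "real \<Rightarrow> 'a \<Rightarrow> real"
    and u :: "real \<Rightarrow> real \<Rightarrow> real"
    and \<phi> :: "real \<Rightarrow> real"
  assumes "prob_space M"
    and "0 < \<alpha>"
    and "permanental_process M \<alpha> {0..} u X"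
    and "AE \<omega> in M. continuous_on {0..} (\<lambda>t. X t \<omega>)"
    and "\<And>\<delta>. 0 < \<delta> \<Longrightarrow> 0 < (SUP t\<in>{0..\<delta>}. u t t)"
    and "mono_on {0..} \<phi>"
    and "\<And>s t. 0 \<le> s \<Longrightarrow> 0 \<le> t \<Longrightarrow> sigma_fun u s t \<le> \<phi> \<bar>t - s\<bar>"
    and "(\<integral>\<^sup>+x\<in>{0<..<1/2}. ennreal (\<phi> x / (x * sqrt (ln (1 / x)))) \<partial>lborel) < \<infinity>"
  shows "AE \<omega> in M. Limsup at_top (\<lambda>t. ereal (X t \<omega> / (ustar u t * ln t))) \<le> 1"
proof -
  interpret prob_space M by fact
  interpret real_permanental M \<alpha> u X
    using assms(2,3) by unfold_locales
  note mono = assms(6) and sig = assms(7)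
  note ustar = ustar_facts[OF mono sig]
  have \<phi>_nonneg: "0 \<le> \<phi> x" if "0 \<le> x" for x
    using sigma_fun_nonneg[of x 0] sig[of 0 x] that by simp
  \<comment> \<open>The summand \<open>(1/2) ^ j\<close> keeps \<open>\<psi>\<close> positive where \<open>\<phi>\<close> vanishes.\<close>
  define \<psi> where "\<psi> j = \<phi> (1 / mesh j) + (1/2) ^ j" for j
  define \<eta> where "\<eta> j = 4 * sqrt (2 ^ j) * \<psi> j" for j
  have \<psi>_pos: "0 < \<psi> j" for j using \<phi>_nonneg by (simp add: \<psi>_def add_nonneg_pos)
  have \<psi>_sig: "sigma_fun u s t \<le> \<psi> j" if "0 \<le> s" "0 \<le> t" "\<bar>t - s\<bar> \<le> 1 / mesh j" for j s t
    using sig[OF that(1,2)] mono_onD[OF mono, of "\<bar>t - s\<bar>" "1 / mesh j"] that(3)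
    by (simp add: \<psi>_def add_increasing2)
  have \<eta>_nonneg: "0 \<le> \<eta> j" for j using \<psi>_pos[of j] by (simp add: \<eta>_def)
  have \<eta>_sum: "summable \<eta>"
  proof -
    have "summable (\<lambda>j. 4 * (\<phi> ((1/2) ^ (2 ^ j)) * sqrt (2 ^ j) + (1/2) ^ j * sqrt (2 ^ j)))"
      by (intro summable_mult summable_add summable_dyadic_half_power
          double_exponential_scale_summable[OF mono \<phi>_nonneg assms(8)])
    then show ?thesis by (simp add: \<eta>_def[abs_def] \<psi>_def mesh_def power_divide algebra_simps)
  qed
  have v1: "0 < ustar u 1" using assms(5)[of 1] by (simp add: ustar_def)
  have v_pos: "0 < ustar u t" if "1 \<le> t" for t
    using v1 ustar(2)[of 1 t] that by simp
  \<comment> \<open>\<open>A p\<close> is the total loss of the chain started on level \<open>p\<close>, and \<open>K p\<close> the resulting bound on the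
    upper limit, with \<open>\<epsilon> = 1 / (p + 1)\<close> on the starting level.\<close>
  define A where "A p = exp (2 * (\<Sum>j. \<eta> (j + p)))" for p
  define K where "K p = A p * (1 + 1 / Suc p) + (A p - 1) / ustar u 1" for p
  have A_ge: "1 \<le> A p" for p
    unfolding A_def using \<eta>_nonneg \<eta>_sum by (simp add: suminf_nonneg summable_iff_shift)
  have "AE \<omega> in M. \<forall>p. \<forall>\<^sub>F n in sequentially. \<forall>i<mesh p.
      X (grid n p i) \<omega> \<le> (1 + 1 / Suc p) * ln n * ustar u (grid n p i)"
    unfolding AE_all_countable
    using ustar(1) v_pos by (intro allI AE_eventually_base) auto
  moreover have "AE \<omega> in M. \<forall>\<^sub>F n in sequentially. \<forall>j. \<forall>i<mesh j. \<forall>k<mesh (Suc j).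
    \<bar>grid n (Suc j) k - grid n j i\<bar> \<le> 1 / mesh j \<longrightarrow>
    X (grid n (Suc j) k) \<omega> \<le> (1 + \<eta> j) * X (grid n j i) \<omega> + (1 + \<eta> j) * \<eta> j * ln n"
    by (rule AE_eventually_links[OF \<psi>_pos \<psi>_sig \<eta>_def])
  moreover have "AE \<omega> in M. \<forall>n j i. 0 \<le> X (grid n j i) \<omega>"
    unfolding AE_all_countable by (intro allI X_nonneg grid_in)
  moreover note assms(4)
  ultimately show ?thesis
  proof eventually_elim
    case (elim \<omega>)
    have "Limsup at_top (\<lambda>t. ereal (X t \<omega> / (ustar u t * ln t))) \<le> ereal (K p)" for p
    proof (rule Limsup_bounded)
      from elim(1) have "\<forall>\<^sub>F n in sequentially. \<forall>i<mesh p.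
        X (grid n p i) \<omega> \<le> (1 + 1 / Suc p) * ln n * ustar u (grid n p i)" by blast
      with elim(2) eventually_ge_at_top[of 2]
      have "\<forall>\<^sub>F n in sequentially. \<forall>t. real n \<le> t \<longrightarrow> t < real n + 1 \<longrightarrow>
        X t \<omega> / (ustar u t * ln t) \<le> K p"
      proof eventually_elim
        case (elim n)
        note n = elim(2)
        show ?case
        proof (intro allI impI)
          fix t assume t: "real n \<le> t" "t < real n + 1"
          define C where "C = (1 + 1 / Suc p) * ln n * ustar u t"
          have L: "0 < ln n" "ln n \<le> ln t" using n t by auto
          note vt = v_pos[of t] ustar(2)[of 1 t]
          have base: "X (grid n p i) \<omega> \<le> C" if i: "i < mesh p" "grid n p i \<le> t" for i
          proof -
            have "ustar u (grid n p i) \<le> ustar u t"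
              using i by (intro ustar(2)) (auto simp: grid_def)
            then have "(1 + 1 / Suc p) * ln n * ustar u (grid n p i) \<le> C"
              unfolding C_def using L by (intro mult_left_mono) auto
            with elim(3) i show ?thesis by force
          qed
          have "X t \<omega> + ln n \<le> A p * (C + ln n)" unfolding A_def
            by (rule sup_bound_from_grid[where x="\<lambda>t. X t \<omega>", OF \<open>continuous_on _ _\<close> _ \<eta>_nonneg \<eta>_sum _ _ base t])
              (use L elim(1) \<open>\<forall>n j i. 0 \<le> X (grid n j i) \<omega>\<close> in auto)
          then have "X t \<omega> \<le> (A p * (1 + 1 / Suc p) * ustar u t + (A p - 1)) * ln n"
            by (simp add: C_def algebra_simps)
          also have "\<dots> \<le> (A p * (1 + 1 / Suc p) * ustar u t + (A p - 1)) * ln t"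
            using L A_ge[of p] vt(1) n t by (intro mult_left_mono add_nonneg_nonneg mult_nonneg_nonneg) auto
          also have "\<dots> = (A p * (1 + 1 / Suc p) + (A p - 1) / ustar u t) * (ustar u t * ln t)"
          proof -
            have "(a * v + b) * l = (a + b / v) * (v * l)" if "v \<noteq> 0" for a b v l :: real
              using that by (simp add: field_simps)
            moreover have "ustar u t \<noteq> 0" using vt(1) n t by simp
            ultimately show ?thesis by blast
          qed
          also have "\<dots> \<le> K p * (ustar u t * ln t)"
            unfolding K_def using A_ge[of p] vt v1 n t L
            by (intro mult_right_mono add_left_mono divide_left_mono) auto
          finally show "X t \<omega> / (ustar u t * ln t) \<le> K p"
            using vt(1) n t L by (subst pos_divide_le_eq) auto
        qed
      qed
      then obtain N where N: "\<And>n t. N \<le> n \<Longrightarrow> real n \<le> t \<Longrightarrow> t < real n + 1 \<Longrightarrow>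
          X t \<omega> / (ustar u t * ln t) \<le> K p"
        unfolding eventually_sequentially by blast
      show "\<forall>\<^sub>F t in at_top. ereal (X t \<omega> / (ustar u t * ln t)) \<le> ereal (K p)"
        unfolding eventually_at_top_linorder
      proof (intro exI[of _ "real N"] allI impI)
        fix t assume "real N \<le> t"
        then show "ereal (X t \<omega> / (ustar u t * ln t)) \<le> ereal (K p)"
          using N[of "nat \<lfloor>t\<rfloor>" t] by (simp add: le_nat_floor)
      qed
    qed
    moreover have lim: "(\<lambda>p. ereal (K p)) \<longlonglongrightarrow> ereal 1"
    proof -
      have "(\<lambda>p. \<Sum>j. \<eta> (j + p)) \<longlonglongrightarrow> 0" by (rule suminf_exist_split2[OF \<eta>_sum])
      then have "A \<longlonglongrightarrow> exp (2 * 0)" unfolding A_def by (intro tendsto_intros)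
      moreover have "(\<lambda>p. 1 / real (Suc p)) \<longlonglongrightarrow> 0"
        using LIMSEQ_inverse_real_of_nat by (simp add: inverse_eq_divide)
      ultimately have "K \<longlonglongrightarrow> exp (2 * 0) * (1 + 0) + (exp (2 * 0) - 1) / ustar u 1"
        unfolding K_def using v1 by (intro tendsto_intros) auto
      then show ?thesis by simp
    qed
    ultimately show ?case
      unfolding one_ereal_def by (intro LIMSEQ_le_const[OF lim]) blast
  qed
qed

end
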